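(* Let $a\ge 3$ and $b\ge 1$ be integers. The equation $x^{2}-(a^{2}b^{2}-2b)y^{2}=-4$ has no solutions in positive integers $x,y$. *)

theory Defs
  imports Main
begin

end

theory Submission
  imports Defs
begin

text \<open>
  With \<open>d = a\<^sup>2b\<^sup>2 - 2b\<close>, the unit \<open>(a\<^sup>2b - 1) + a\<surd>d\<close> has norm 1. Multiplying a solution with
  \<open>y \<ge> 2\<close> by the inverse of this unit gives a solution with strictly smaller nonzero \<open>\<bar>y\<bar>\<close>,
  so by descent there would be a solution with \<open>y = 1\<close>; but \<open>d - 4\<close> lies strictly
  between \<open>(ab - 1)\<^sup>2\<close> and \<open>(ab)\<^sup>2\<close>, except that it is 3 for \<open>a = 3, b = 1\<close>.
\<close>

lemma not_square_between:
  fixes x n :: int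
  assumes "n \<ge> 0" "n\<^sup>2 < x\<^sup>2" "x\<^sup>2 < (n + 1)\<^sup>2"
  shows False
proof -
  have "n < \<bar>x\<bar>" using assms(2) power_less_imp_less_base[of n 2 "\<bar>x\<bar>"] by simp
  moreover have "\<bar>x\<bar> < n + 1"
    using assms(1,3) power_less_imp_less_base[of "\<bar>x\<bar>" 2 "n + 1"] by simp
  ultimately show False by simp
qed

lemma no_solution_with_y_one:
  fixes a b x :: int
  assumes "a \<ge> 3" "b \<ge> 1"
  shows "x\<^sup>2 \<noteq> a\<^sup>2 * b\<^sup>2 - 2 * b - 4"
proof
  assume x: "x\<^sup>2 = a\<^sup>2 * b\<^sup>2 - 2 * b - 4"
  have ab: "3 * b \<le> a * b" using assms by (simp add: mult_right_mono)
  show False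
  proof (cases "a = 3 \<and> b = 1")
    case True
    then show False using x not_square_between[of 1 x] by simp
  next
    case False
    \<comment> \<open>Expanding the square, this is exactly
      \<open>(a * b - 1)\<^sup>2 < a\<^sup>2 * b\<^sup>2 - 2 * b - 4\<close>.\<close>
    have "2 * b + 5 < 2 * (a * b)"
    proof (cases "b = 1")
      case True
      then show ?thesis using False assms by simp
    next
      case False
      then have "b \<ge> 2" using assms by simp
      then show ?thesis using ab by linarith
    qed
    then have "(a * b - 1)\<^sup>2 < x\<^sup>2" unfolding x by (simp add: power2_eq_square algebra_simps)
    moreover have "x\<^sup>2 < (a * b - 1 + 1)\<^sup>2" unfolding x using assms by (simp add: power_mult_distrib)
    ultimately show False using not_square_between[of "a * b - 1" x] ab assms by simp
  qed
qed

text \<open>The descent can produce a negative second coordinate, so \<open>y\<close> is only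
  assumed nonzero and the induction is on its absolute value.\<close>

lemma no_solution:
  fixes a b x y :: int
  assumes "a \<ge> 3" "b \<ge> 1" "y \<noteq> 0"
  shows "x\<^sup>2 - (a\<^sup>2 * b\<^sup>2 - 2 * b) * y\<^sup>2 \<noteq> -4"
  using assms(3)
proof (induction "nat \<bar>y\<bar>" arbitrary: x y rule: less_induct)
  case less
  show ?case
  proof
    assume "x\<^sup>2 - (a\<^sup>2 * b\<^sup>2 - 2 * b) * y\<^sup>2 = -4"
    then have sol: "\<bar>x\<bar>\<^sup>2 - (a\<^sup>2 * b\<^sup>2 - 2 * b) * \<bar>y\<bar>\<^sup>2 = -4" by simp
    define X Y s where "X = \<bar>x\<bar>" and "Y = \<bar>y\<bar>" and "s = a\<^sup>2 * b"
    \<comment> \<open>Coordinates of (X + Y sqrt d)((s - 1) - a sqrt d), where d is the coefficient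
      of \<open>Y\<^sup>2\<close>.\<close>
    define X' Y' where "X' = (s - 1) * X - (a\<^sup>2 * b\<^sup>2 - 2 * b) * a * Y"
      and "Y' = (s - 1) * Y - a * X"
    have XY: "X\<^sup>2 - (a\<^sup>2 * b\<^sup>2 - 2 * b) * Y\<^sup>2 = -4" "X \<ge> 0"
      using sol by (simp_all add: X_def Y_def)
    have "Y \<noteq> 1" using XY no_solution_with_y_one[OF assms(1,2), of X] by auto
    then have Y2: "Y \<ge> 2" using less.prems by (simp add: Y_def)
    have "a\<^sup>2 \<ge> 3\<^sup>2" using assms by (intro power_mono) auto
    moreover have "a\<^sup>2 * 1 \<le> s" unfolding s_def using assms by (intro mult_left_mono) auto
    ultimately have s: "s \<ge> 9" "a\<^sup>2 \<le> s" by auto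
    have aX: "(a * X)\<^sup>2 = s * (s - 2) * Y\<^sup>2 - 4 * a\<^sup>2"
    proof -
      have "(a * X)\<^sup>2 = a\<^sup>2 * ((a\<^sup>2 * b\<^sup>2 - 2 * b) * Y\<^sup>2 - 4)"
        using XY(1) by (simp add: power_mult_distrib)
      then show ?thesis by (simp add: s_def power2_eq_square algebra_simps)
    qed
    \<comment> \<open>Here \<open>Y \<ge> 2\<close> enters: 8(s - 2) exceeds 4s, which is at least
      \<open>4 * a\<^sup>2\<close>, because s > 4.\<close>
    have "2 * (s - 2) * 2\<^sup>2 \<le> 2 * (s - 2) * Y\<^sup>2"
      using s Y2 by (intro mult_left_mono power_mono) auto
    then have "4 * a\<^sup>2 < 2 * (s - 2) * Y\<^sup>2" using s by simp
    then have "((s - 2) * Y)\<^sup>2 < (a * X)\<^sup>2"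
      unfolding aX by (simp add: power2_eq_square algebra_simps)
    then have "(s - 2) * Y < a * X"
      using power_less_imp_less_base[of "(s - 2) * Y" 2 "a * X"] assms XY by simp
    then have up: "Y' < Y" by (simp add: Y'_def algebra_simps)
    have "(a * X)\<^sup>2 < (s * Y)\<^sup>2"
    proof -
      have "0 < 2 * s * Y\<^sup>2 + 4 * a\<^sup>2" using s Y2 assms by (intro add_pos_pos) auto
      then show ?thesis unfolding aX by (simp add: power2_eq_square algebra_simps)
    qed
    then have "a * X < s * Y"
      using power_less_imp_less_base[of "a * X" 2 "s * Y"] s Y2 by simp
    then have low: "- Y < Y'" by (simp add: Y'_def algebra_simps)
    \<comment> \<open>The norm is multiplicative, and the factor has norm (s - 1)^2 - s(s - 2) =
      1.\<close>
    have "X'\<^sup>2 - (a\<^sup>2 * b\<^sup>2 - 2 * b) * Y'\<^sup>2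
        = X\<^sup>2 - (a\<^sup>2 * b\<^sup>2 - 2 * b) * Y\<^sup>2"
      by (simp add: X'_def Y'_def s_def power2_eq_square algebra_simps)
    then have sol': "X'\<^sup>2 - (a\<^sup>2 * b\<^sup>2 - 2 * b) * Y'\<^sup>2 = -4" using XY by simp
    have "X'\<^sup>2 \<noteq> -4" using zero_le_power2[of X'] by linarith
    then have "Y' \<noteq> 0" using sol' by auto
    moreover have "nat \<bar>Y'\<bar> < nat \<bar>y\<bar>" using up low unfolding Y_def by linarith
    ultimately show False using less.hyps sol' by blast
  qed
qed

theorem theorem14:
  fixes a b :: int
  assumes "a \<ge> 3" and "b \<ge> 1"
  shows "\<not> (\<exists>x y :: int. x > 0 \<and> y > 0 \<and> x^2 - (a^2 * b^2 - 2 * b) * y^2 = -4)"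
  using no_solution[OF assms] by (metis less_irrefl)

end
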